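(* Let $\mathfrak a_{n,m}$ be the number of $\sigma\in\mathcal{I}_n(011,120)$ with $\max(\sigma)=m$. Let $\mathfrak b_{n,k}$ be the number of words $\omega\in\mathcal W_{n,k}$ avoiding $120$ in which all letters are distinct. Let $\mathfrak c_{n,k}$ be the number of words $\omega\in\mathcal W_{n,k}$ avoiding $120$ in which no nonzero letter is repeated (i.e. $\omega_i=\omega_j\neq 0$ implies $i=j$). Then for all integers $0<m<n$, $$\mathfrak a_{n,m}=\sum_{p=m+1}^{n}\Big(\mathfrak c_{n-p,m}+\sum_{j=1}^{m-1}\mathfrak a_{p-1,j}\,\mathfrak b_{n-p,m-j-1}\Big).$$
   Context: For $n\in\mathbb N$, an inversion sequence of size $n$ is a sequence $\sigma=(\sigma_1,\dots,\sigma_n)\in\mathbb N^n$ with $\sigma_i<i$ for all $i$. An integer sequence contains a pattern $\rho$ (a finite integer sequence such as $011$ or $120$) if it has a subsequence order-isomorphic to $\rho$, and avoids $\rho$ otherwise. $\mathcal{I}_n(P)$ denotes the set of inversion sequences of size $n$ avoiding every pattern in the set $P$. $\mathcal W_{n,k}=\{0,\dots,k-1\}^n$ is the set of words of length $n$ over the alphabet $\{0,\dots,k-1\}$. $\max(\sigma)$ is the largest entry of $\sigma$. *)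

theory Defs
  imports Main "HOL-Library.Sublist"
begin

definition order_isomorphic :: "'a::linorder list \<Rightarrow> 'b::linorder list \<Rightarrow> bool" where
  "order_isomorphic xs ys \<longleftrightarrow> length xs = length ys \<and>
     (\<forall>i<length xs. \<forall>j<length xs. xs ! i < xs ! j \<longleftrightarrow> ys ! i < ys ! j)"

definition contains_pattern :: "nat list \<Rightarrow> nat list \<Rightarrow> bool" where
  "contains_pattern \<sigma> \<rho> \<longleftrightarrow> (\<exists>\<tau>. subseq \<tau> \<sigma> \<and> order_isomorphic \<tau> \<rho>)"

abbreviation avoids_pattern :: "nat list \<Rightarrow> nat list \<Rightarrow> bool" where
  "avoids_pattern \<sigma> \<rho> \<equiv> \<not> contains_pattern \<sigma> \<rho>"

(* List positions start at 0, so the 1-based condition sigma_i < i reads as follows. *)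
definition inversion_seqs :: "nat \<Rightarrow> nat list set" where
  "inversion_seqs n = {\<sigma>. length \<sigma> = n \<and> (\<forall>i<n. \<sigma> ! i < i + 1)}"

definition avoiding_inversion_seqs :: "nat \<Rightarrow> nat list set \<Rightarrow> nat list set" where
  "avoiding_inversion_seqs n P = {\<sigma> \<in> inversion_seqs n. \<forall>\<rho>\<in>P. avoids_pattern \<sigma> \<rho>}"

definition words :: "nat \<Rightarrow> nat \<Rightarrow> nat list set" where
  "words n k = {\<omega>. length \<omega> = n \<and> set \<omega> \<subseteq> {0..<k}}"

(* Max is unspecified on the empty set, so num_a is meaningful only for n > 0. *)
definition num_a :: "nat \<Rightarrow> nat \<Rightarrow> nat" where
  "num_a n m = card {\<sigma> \<in> avoiding_inversion_seqs n {[0,1,1],[1,2,0]}. Max (set \<sigma>) = m}"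

definition num_b :: "nat \<Rightarrow> nat \<Rightarrow> nat" where
  "num_b n k = card {\<omega> \<in> words n k. avoids_pattern \<omega> [1,2,0] \<and> distinct \<omega>}"

definition num_c :: "nat \<Rightarrow> nat \<Rightarrow> nat" where
  "num_c n k = card {\<omega> \<in> words n k. avoids_pattern \<omega> [1,2,0] \<and>
     (\<forall>i<n. \<forall>j<n. \<omega> ! i = \<omega> ! j \<and> \<omega> ! j \<noteq> 0 \<longrightarrow> i = j)}"

end

theory Submission imports Defs begin

text \<open>
  Since \<open>m > 0\<close>, the maximum \<open>m\<close> occurs exactly once, say at the 1-based position \<open>p\<close>, and
  \<open>\<sigma> = \<alpha> @ m # \<beta>\<close> with \<open>p > m\<close>. A value of \<open>\<beta>\<close> smaller than a value of \<open>\<alpha>\<close> would complete a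
  \<open>120\<close> through \<open>m\<close>, so all of \<open>\<beta>\<close> lies weakly above \<open>j = max \<alpha>\<close>. If \<open>j = 0\<close>, then \<open>\<alpha>\<close> is
  constant and \<open>\<beta>\<close> is a word over \<open>{0..<m}\<close> without repeated nonzero letters; if \<open>j > 0\<close>, then \<open>j\<close>
  itself may not recur, and subtracting \<open>j + 1\<close> turns \<open>\<beta>\<close> into a word over \<open>{0..<m-j-1}\<close> with
  distinct letters.
\<close>

section \<open>Subsequences and the two patterns in elementary form\<close>

lemma subseq_map_iff:
  "subseq ys (map f xs) \<longleftrightarrow> (\<exists>zs. ys = map f zs \<and> subseq zs xs)"
  by (auto simp: subseq_conv_nths nths_map)

lemma set_subset_if_subseq: "subseq xs ys \<Longrightarrow> set xs \<subseteq> set ys"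
  by (auto simp: subseq_conv_nths set_nths)

text \<open>Diagonal comparisons are false on both sides, so six remain. Equality of two entries is
  encoded as the failure of both strict comparisons, which is what turns \<open>[0,1,1]\<close> into
  a repeated letter.\<close>

lemma order_isomorphic_triple:
  "order_isomorphic \<tau> [a,b,c] \<longleftrightarrow> (\<exists>x y z. \<tau> = [x,y,z] \<and>
    (x < y \<longleftrightarrow> a < b) \<and> (x < z \<longleftrightarrow> a < c) \<and> (y < x \<longleftrightarrow> b < a) \<and>
    (y < z \<longleftrightarrow> b < c) \<and> (z < x \<longleftrightarrow> c < a) \<and> (z < y \<longleftrightarrow> c < b))"
proof (cases "length \<tau> = 3")
  case True
  then obtain x y z where \<tau>: "\<tau> = [x,y,z]"
    by (auto simp: length_Suc_conv numeral_3_eq_3)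
  have 3: "(\<forall>i<Suc (Suc (Suc 0)). P i) \<longleftrightarrow> P 0 \<and> P (Suc 0) \<and> P (Suc (Suc 0))" for P
    by (auto simp: less_Suc_eq)
  have l: "length [x,y,z] = Suc (Suc (Suc 0))" "length [a,b,c] = Suc (Suc (Suc 0))" by simp_all
  show ?thesis
    unfolding order_isomorphic_def \<tau> l 3 by simp
qed (auto simp: order_isomorphic_def)

lemma avoids_120_iff:
  "avoids_pattern \<sigma> [1,2,0] \<longleftrightarrow> (\<forall>x y z. subseq [x,y,z] \<sigma> \<longrightarrow> z < x \<longrightarrow> \<not> x < y)"
proof -
  have "order_isomorphic \<tau> [1,2,0::nat] \<longleftrightarrow> (\<exists>x y z. \<tau> = [x,y,z] \<and> z < x \<and> x < y)" for \<tau> :: "nat list"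
    unfolding order_isomorphic_triple by (intro ex_cong1) linarith
  then show ?thesis
    by (simp only: contains_pattern_def) blast
qed

lemma avoids_011_iff:
  "avoids_pattern \<sigma> [0,1,1] \<longleftrightarrow> (\<forall>x y. subseq [x,y,y] \<sigma> \<longrightarrow> \<not> x < y)"
proof -
  have "order_isomorphic \<tau> [0,1,1::nat] \<longleftrightarrow> (\<exists>x y z. \<tau> = [x,y,z] \<and> x < y \<and> y = z)" for \<tau> :: "nat list"
    unfolding order_isomorphic_triple by (intro ex_cong1) linarith
  then show ?thesis
    by (simp only: contains_pattern_def) blast
qed

section \<open>Pattern 120 under shifts and across a maximal letter\<close>

lemma avoids_120_map_add:
  "avoids_pattern (map (\<lambda>x. x + c) \<omega>) [1,2,0] \<longleftrightarrow> avoids_pattern \<omega> [1,2,0]"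
  unfolding avoids_120_iff subseq_map_iff by (fastforce simp: Cons_eq_map_conv)

text \<open>For the converse: in an occurrence \<open>x, y, z\<close> of 120 only the middle letter
  can be \<open>m\<close>, as \<open>x\<close> and \<open>z\<close> are smaller than
  \<open>y\<close>. An occurrence inside neither half thus starts in \<alpha> and ends in \<beta>,
  against the order between the halves.\<close>

lemma avoids_120_append_max:
  assumes "\<forall>x\<in>set \<alpha>. x < m" "\<forall>y\<in>set \<beta>. y < m"
  shows "avoids_pattern (\<alpha> @ m # \<beta>) [1,2,0] \<longleftrightarrow>
    avoids_pattern \<alpha> [1,2,0] \<and> avoids_pattern \<beta> [1,2,0] \<and> (\<forall>x\<in>set \<alpha>. \<forall>y\<in>set \<beta>. x \<le> y)"
    (is "?L \<longleftrightarrow> ?R")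
proof
  assume L: ?L
  have "x \<le> y" if "x \<in> set \<alpha>" "y \<in> set \<beta>" for x y
  proof -
    have "subseq ([x] @ [m,y]) (\<alpha> @ m # \<beta>)"
      using that by (intro list_emb_append_mono) (simp_all add: subseq_singleton_left)
    then show ?thesis
      using L that assms unfolding avoids_120_iff by fastforce
  qed
  moreover have "avoids_pattern \<alpha> [1,2,0]" "avoids_pattern \<beta> [1,2,0]"
    using L unfolding avoids_120_iff
    by (metis list_emb_append_mono append_Nil2 list_emb_Nil, metis list_emb_append2 list_emb_Cons)
  ultimately show ?R by blast
next
  assume R: ?R
  show ?L
    unfolding avoids_120_iff
  proof (intro allI impI notI)
    fix x y z assume s: "subseq [x,y,z] (\<alpha> @ m # \<beta>)" and "z < x" "x < y"
    have "y \<le> m"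
      using set_subset_if_subseq[OF s] assms by fastforce
    have "\<exists>us vs. [x,y,z] = us @ vs \<and> subseq us \<alpha> \<and> subseq vs (m # \<beta>)"
      using s by (simp add: subseq_append_iff)
    then obtain us vs where e: "[x,y,z] = us @ vs" and u: "subseq us \<alpha>" and v: "subseq vs (m # \<beta>)"
      by blast
    \<comment> \<open>The letter \<open>m\<close> is either skipped or matched as the first letter
      of \<open>vs\<close>.\<close>
    have v': "vs = [] \<or> subseq vs \<beta> \<or> (\<exists>ws. vs = m # ws \<and> subseq ws \<beta>)"
      using v by (cases vs) (auto split: if_splits)
    have "us = [] \<and> vs = [x,y,z] \<or> us = [x] \<and> vs = [y,z] \<or> us = [x,y] \<and> vs = [z]
      \<or> us = [x,y,z] \<and> vs = []"
      using e by (auto simp: Cons_eq_append_conv)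
    then consider "us = []" "vs = [x,y,z]" | "us = [x]" "vs = [y,z]" | "us = [x,y]" "vs = [z]"
      | "us = [x,y,z]" "vs = []"
      by blast
    then show False
    proof cases
      case 1
      then have "subseq [x,y,z] \<beta>"
        using v' \<open>x < y\<close> \<open>y \<le> m\<close> by simp
      then show False
        using R \<open>z < x\<close> \<open>x < y\<close> unfolding avoids_120_iff by blast
    next
      case 4
      then show False
        using u R \<open>z < x\<close> \<open>x < y\<close> unfolding avoids_120_iff by blast
    next
      case 2
      then have "x \<in> set \<alpha>"
        using u by (simp add: subseq_singleton_left)
      have "subseq [z] \<beta>"
        using 2 v' by (auto dest: subseq_Cons')
      then have "z \<in> set \<beta>" by (simp add: subseq_singleton_left)
      then show False using R \<open>x \<in> set \<alpha>\<close> \<open>z < x\<close> by (meson not_le)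
    next
      case 3
      then have "x \<in> set \<alpha>"
        using set_subset_if_subseq[OF u] by simp
      moreover have "z = m \<or> z \<in> set \<beta>"
        using 3 v' by (auto simp: subseq_singleton_left)
      then have "z \<in> set \<beta>" using \<open>z < x\<close> \<open>x < y\<close> \<open>y \<le> m\<close> by simp
      ultimately show False using R \<open>z < x\<close> by (meson not_le)
    qed
  qed
qed

section \<open>Pattern 011 and repeated nonzero letters\<close>

lemma distinct_filter_iff_nth:
  "distinct (filter P xs) \<longleftrightarrow>
    (\<forall>i<length xs. \<forall>j<length xs. xs ! i = xs ! j \<and> P (xs ! j) \<longrightarrow> i = j)"
proof (induction xs)
  case (Cons x xs)
  then show ?case
    by (auto simp: All_less_Suc2 in_set_conv_nth)
qed simp

lemma subseq_pair_if_not_distinct: "\<not> distinct xs \<Longrightarrow> \<exists>x. subseq [x,x] xs"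
proof (induction xs)
  case (Cons a xs)
  show ?case
  proof (cases "a \<in> set xs")
    case True
    then have "subseq [a,a] (a # xs)" by (simp add: subseq_singleton_left)
    then show ?thesis by blast
  next
    case False
    then obtain x where "subseq [x,x] xs" using Cons by auto
    then have "subseq [x,x] (a # xs)" by blast
    then show ?thesis by blast
  qed
qed simp

text \<open>An inversion sequence starts with \<open>0\<close>, so a repeated nonzero value completes a \<open>011\<close>.\<close>

lemma inversion_seq_avoids_011_iff:
  assumes "\<sigma> \<in> inversion_seqs n"
  shows "avoids_pattern \<sigma> [0,1,1] \<longleftrightarrow> distinct (filter (\<lambda>x. x \<noteq> 0) \<sigma>)"
proof (cases \<sigma>)
  case Nil
  then show ?thesis using avoids_011_iff[of "[]"] by simp
next
  case (Cons a \<tau>)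
  have "a = 0" using assms Cons by (auto simp: inversion_seqs_def)
  show ?thesis
  proof
    assume L: "avoids_pattern \<sigma> [0,1,1]"
    show "distinct (filter (\<lambda>x. x \<noteq> 0) \<sigma>)"
    proof (rule ccontr)
      assume "\<not> distinct (filter (\<lambda>x. x \<noteq> 0) \<sigma>)"
      \<comment> \<open>The head is 0 and is filtered out, so the repetition lies in \<tau> and the
        head is free to play the smallest letter of 011.\<close>
      then obtain x where x: "subseq [x,x] (filter (\<lambda>x. x \<noteq> 0) \<tau>)"
        using subseq_pair_if_not_distinct Cons \<open>a = 0\<close> by fastforce
      then have "x \<noteq> 0" using set_subset_if_subseq by fastforce
      moreover have "subseq [0,x,x] \<sigma>"
        using subseq_order.trans[OF x subseq_filter_left] Cons \<open>a = 0\<close> by simp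
      ultimately show False using L unfolding avoids_011_iff by fastforce
    qed
  next
    assume R: "distinct (filter (\<lambda>x. x \<noteq> 0) \<sigma>)"
    show "avoids_pattern \<sigma> [0,1,1]"
      unfolding avoids_011_iff
    proof (intro allI impI notI)
      fix x y :: nat assume "subseq [x,y,y] \<sigma>" "x < y"
      \<comment> \<open>Both copies of \<open>y\<close> survive the filter because \<open>y\<close>
        exceeds a natural number; a subsequence of a distinct list would have to be
        distinct.\<close>
      then have "subseq (filter (\<lambda>x. x \<noteq> 0) [x,y,y]) (filter (\<lambda>x. x \<noteq> 0) \<sigma>)"
        by (intro subseq_filter)
      then obtain N where "filter (\<lambda>x. x \<noteq> 0) [x,y,y] = nths (filter (\<lambda>x. x \<noteq> 0) \<sigma>) N"
        by (auto simp: subseq_conv_nths)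
      then have "distinct (filter (\<lambda>x. x \<noteq> 0) [x,y,y])"
        using distinct_nthsI[OF R] by metis
      then show False using \<open>x < y\<close> by (auto split: if_splits)
    qed
  qed
qed

section \<open>The counted sets and their decomposition at the maximum\<close>

definition a_seqs :: "nat \<Rightarrow> nat \<Rightarrow> nat list set" where
  "a_seqs n m = {\<sigma> \<in> avoiding_inversion_seqs n {[0,1,1],[1,2,0]}. Max (set \<sigma>) = m}"

definition b_words :: "nat \<Rightarrow> nat \<Rightarrow> nat list set" where
  "b_words n k = {\<omega> \<in> words n k. avoids_pattern \<omega> [1,2,0] \<and> distinct \<omega>}"

definition c_words :: "nat \<Rightarrow> nat \<Rightarrow> nat list set" where
  "c_words n k = {\<omega> \<in> words n k. avoids_pattern \<omega> [1,2,0] \<and> distinct (filter (\<lambda>x. x \<noteq> 0) \<omega>)}"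

lemma num_c_eq_card: "num_c n k = card (c_words n k)"
  unfolding num_c_def c_words_def
  by (rule arg_cong[where f = card]) (auto simp: distinct_filter_iff_nth words_def)

lemma mem_avoiding_iff:
  "\<sigma> \<in> avoiding_inversion_seqs n {[0,1,1],[1,2,0]} \<longleftrightarrow>
    length \<sigma> = n \<and> (\<forall>i<n. \<sigma> ! i \<le> i) \<and> distinct (filter (\<lambda>x. x \<noteq> 0) \<sigma>) \<and> avoids_pattern \<sigma> [1,2,0]"
  using inversion_seq_avoids_011_iff[of \<sigma> n]
  by (auto simp: avoiding_inversion_seqs_def inversion_seqs_def less_Suc_eq_le)

text \<open>From the position of \<open>m\<close> onward every letter is at most
  \<open>m \<le> length \<alpha>\<close>, so the inversion bound only constrains \<alpha>.
  Distinctness of nonzero letters across the halves is what forces a shared letter to be 0.\<close>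

lemma append_max_mem_avoiding_iff:
  assumes "\<forall>x\<in>set \<alpha>. x < m" "\<forall>y\<in>set \<beta>. y < m" "0 < m" "m \<le> length \<alpha>"
  shows "\<alpha> @ m # \<beta> \<in> avoiding_inversion_seqs n {[0,1,1],[1,2,0]} \<longleftrightarrow>
    length \<alpha> + length \<beta> + 1 = n \<and>
    \<alpha> \<in> avoiding_inversion_seqs (length \<alpha>) {[0,1,1],[1,2,0]} \<and>
    avoids_pattern \<beta> [1,2,0] \<and> distinct (filter (\<lambda>x. x \<noteq> 0) \<beta>) \<and>
    (\<forall>x\<in>set \<alpha>. \<forall>y\<in>set \<beta>. x \<le> y \<and> (x = y \<longrightarrow> x = 0))"
proof -
  have "(\<forall>i<n. (\<alpha> @ m # \<beta>) ! i \<le> i) \<longleftrightarrow> (\<forall>i<length \<alpha>. \<alpha> ! i \<le> i)"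
    if "length \<alpha> + length \<beta> + 1 = n"
  proof
    assume "\<forall>i<n. (\<alpha> @ m # \<beta>) ! i \<le> i"
    then show "\<forall>i<length \<alpha>. \<alpha> ! i \<le> i"
      using that by (metis nth_append trans_less_add1)
  next
    assume a: "\<forall>i<length \<alpha>. \<alpha> ! i \<le> i"
    show "\<forall>i<n. (\<alpha> @ m # \<beta>) ! i \<le> i"
    proof (intro allI impI)
      fix i assume "i < n"
      show "(\<alpha> @ m # \<beta>) ! i \<le> i"
      proof (cases "i < length \<alpha>")
        case True
        then show ?thesis using a by (simp add: nth_append)
      next
        case False
        have "(m # \<beta>) ! (i - length \<alpha>) \<in> set (m # \<beta>)"
          using \<open>i < n\<close> that False by (intro nth_mem) auto
        then have "(m # \<beta>) ! (i - length \<alpha>) \<le> m" using assms(2) by fastforce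
        then show ?thesis using False assms(4) by (simp add: nth_append)
      qed
    qed
  qed
  moreover have "m \<notin> set \<alpha>" "m \<notin> set \<beta>" using assms by auto
  ultimately show ?thesis
    using avoids_120_append_max[OF assms(1,2)] \<open>0 < m\<close> unfolding mem_avoiding_iff by auto
qed

lemma finite_words: "finite (words n k)"
proof -
  have "words n k = {\<omega>. set \<omega> \<subseteq> {0..<k} \<and> length \<omega> = n}" by (auto simp: words_def)
  then show ?thesis by (simp add: finite_lists_length_eq)
qed

lemma finite_a_seqs: "finite (a_seqs n m)"
proof (rule finite_subset)
  show "a_seqs n m \<subseteq> words n (Suc n)"
    using less_Suc_eq_le le_less_trans
    by (fastforce simp: a_seqs_def mem_avoiding_iff words_def in_set_conv_nth simp del: One_nat_def)
qed (rule finite_words)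

text \<open>Shifting by \<open>j + 1\<close> is an order-preserving bijection from the letters below
  \<open>m - j - 1\<close> onto those strictly between \<open>j\<close> and \<open>m\<close>. If
  \<open>m \<le> j + 1\<close>, truncated subtraction gives the empty alphabet, matching the empty
  interval.\<close>

lemma shifted_b_words_iff:
  "\<beta> \<in> map (\<lambda>x. x + (j + 1)) ` b_words r (m - j - 1) \<longleftrightarrow>
    length \<beta> = r \<and> avoids_pattern \<beta> [1,2,0] \<and> distinct \<beta> \<and> (\<forall>y\<in>set \<beta>. j < y \<and> y < m)"
    (is "?L \<longleftrightarrow> ?R")
proof
  assume ?L
  then obtain \<omega> where "\<omega> \<in> b_words r (m - j - 1)" "\<beta> = map (\<lambda>x. x + (j + 1)) \<omega>" by blast
  moreover have "inj_on (\<lambda>x. Suc (x + j)) (set \<omega>)" by (simp add: inj_on_def)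
  ultimately show ?R
    unfolding b_words_def words_def
    by (auto simp: avoids_120_map_add[of "j+1", simplified] distinct_map)
next
  assume R: ?R
  define \<omega> where "\<omega> = map (\<lambda>y. y - (j + 1)) \<beta>"
  \<comment> \<open>The truncated subtraction loses nothing, since every letter of \<beta> is at
    least \<open>j + 1\<close>.\<close>
  have \<beta>: "\<beta> = map (\<lambda>x. x + (j + 1)) \<omega>"
    using R unfolding \<omega>_def map_map by (intro map_idI[symmetric]) (auto simp: Suc_leI)
  have "avoids_pattern \<omega> [1,2,0]" "distinct \<omega>"
    using R avoids_120_map_add unfolding \<beta> by (blast, simp add: distinct_map)
  moreover have "\<omega> \<in> words r (m - j - 1)"
    using R by (auto simp: words_def \<omega>_def)
  ultimately show ?L using \<beta> by (simp add: b_words_def)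
qed

text \<open>\<open>p\<close> is the 1-based position of \<open>m\<close>, and \<open>j\<close> is
  the maximum of the left half. The value 0 is separate because a zero, unlike a positive maximum,
  may recur on the right. Keeping pairs instead of concatenations makes each piece a product, ready
  for counting.\<close>

definition splits :: "nat \<Rightarrow> nat \<Rightarrow> nat \<Rightarrow> (nat list \<times> nat list) set" where
  "splits n m p = {replicate (p - 1) 0} \<times> c_words (n - p) m \<union>
    (\<Union>j\<in>{1..m-1}. a_seqs (p - 1) j \<times> map (\<lambda>x. x + (j + 1)) ` b_words (n - p) (m - j - 1))"

lemma Max_replicate_zero_iff:
  assumes "\<alpha> \<noteq> []"
  shows "Max (set \<alpha>) = 0 \<longleftrightarrow> \<alpha> = replicate (length \<alpha>) (0::nat)"
proof
  assume "Max (set \<alpha>) = 0"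
  then show "\<alpha> = replicate (length \<alpha>) (0::nat)"
    by (metis List.finite_set Max_ge le_zero_eq replicate_length_same)
next
  assume "\<alpha> = replicate (length \<alpha>) (0::nat)"
  then show "Max (set \<alpha>) = 0"
    using assms by (metis Max_singleton length_0_conv set_replicate)
qed

text \<open>After the reduction to conditions on the halves, the only link between \<alpha> and
  \<beta> is the cross condition on their letters. It depends on \<alpha> through its maximum alone,
  which gives the two shapes in \<open>splits\<close>.\<close>

lemma mem_splits_iff:
  assumes "0 < m" "m < p" "p \<le> n"
  shows "(\<alpha>, \<beta>) \<in> splits n m p \<longleftrightarrow>
    length \<alpha> = p - 1 \<and> (\<forall>x\<in>set \<alpha>. x < m) \<and> (\<forall>y\<in>set \<beta>. y < m) \<and>
    \<alpha> @ m # \<beta> \<in> avoiding_inversion_seqs n {[0,1,1],[1,2,0]}"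
    (is "_ \<longleftrightarrow> ?R")
proof (cases "length \<alpha> = p - 1")
  case False
  then show ?thesis
    by (auto simp: splits_def a_seqs_def mem_avoiding_iff simp del: One_nat_def)
next
  case len: True
  \<comment> \<open>Here \<open>p > m > 0\<close> gives \<open>p - 1 > 0\<close>, so
    \<open>Max (set \<alpha>)\<close> is meaningful.\<close>
  have ne: "\<alpha> \<noteq> []" using len assms by auto
  have Max_less: "Max (set \<alpha>) < m \<longleftrightarrow> (\<forall>x\<in>set \<alpha>. x < m)"
    using ne by simp
  define inv where "inv \<longleftrightarrow> \<alpha> \<in> avoiding_inversion_seqs (p - 1) {[0,1,1],[1,2,0]}"
  have R: "?R \<longleftrightarrow> Max (set \<alpha>) < m \<and> (\<forall>y\<in>set \<beta>. y < m) \<and> length \<beta> = n - p \<and> inv \<and>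
    avoids_pattern \<beta> [1,2,0] \<and> distinct (filter (\<lambda>x. x \<noteq> 0) \<beta>) \<and>
    (\<forall>x\<in>set \<alpha>. \<forall>y\<in>set \<beta>. x \<le> y \<and> (x = y \<longrightarrow> x = 0))"
  proof (cases "(\<forall>x\<in>set \<alpha>. x < m) \<and> (\<forall>y\<in>set \<beta>. y < m)")
    case True
    have eq: "length \<alpha> + length \<beta> + 1 = n \<longleftrightarrow> length \<beta> = n - p" and "m \<le> length \<alpha>"
      using len assms by auto
    have "\<alpha> @ m # \<beta> \<in> avoiding_inversion_seqs n {[0,1,1],[1,2,0]} \<longleftrightarrow>
        length \<beta> = n - p \<and> inv \<and> avoids_pattern \<beta> [1,2,0] \<and> distinct (filter (\<lambda>x. x \<noteq> 0) \<beta>) \<and>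
        (\<forall>x\<in>set \<alpha>. \<forall>y\<in>set \<beta>. x \<le> y \<and> (x = y \<longrightarrow> x = 0))"
      unfolding append_max_mem_avoiding_iff[OF True[THEN conjunct1] True[THEN conjunct2]
        \<open>0 < m\<close> \<open>m \<le> length \<alpha>\<close>] eq
      unfolding inv_def len by (rule refl)
    then show ?thesis
      using True len by (simp only: Max_less simp_thms)
  next
    case False
    then have "\<not> ?R" "\<not> (Max (set \<alpha>) < m \<and> (\<forall>y\<in>set \<beta>. y < m))"
      unfolding Max_less by blast+
    then show ?thesis by argo
  qed
  show ?thesis
  proof (cases "Max (set \<alpha>) = 0")
    case True
    then have \<alpha>: "\<alpha> = replicate (p - 1) 0" using Max_replicate_zero_iff[OF ne] len by simp
    \<comment> \<open>An all-zero prefix is always admissible and makes the cross condition trivial,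
      so only the requirements of \<open>c_words\<close> on \<beta> remain.\<close>
    have "filter (\<lambda>x. x \<noteq> 0) \<alpha> = []" "\<forall>x\<in>set \<alpha>. x = 0" unfolding \<alpha> by auto
    moreover have "avoids_pattern \<alpha> [1,2,0]"
      unfolding avoids_120_iff
    proof (intro allI impI)
      fix x y z assume "subseq [x,y,z] \<alpha>" "z < x"
      then show "\<not> x < y"
        using set_subset_if_subseq \<open>\<forall>x\<in>set \<alpha>. x = 0\<close> by fastforce
    qed
    moreover have "\<forall>i<length \<alpha>. \<alpha> ! i \<le> i"
      using \<open>\<forall>x\<in>set \<alpha>. x = 0\<close> nth_mem by fastforce
    ultimately have inv
      using len unfolding inv_def mem_avoiding_iff by simp
    have "(\<alpha>, \<beta>) \<in> splits n m p \<longleftrightarrow> \<beta> \<in> c_words (n - p) m"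
      using True \<alpha> by (auto simp: splits_def a_seqs_def)
    also have "\<dots> \<longleftrightarrow> ?R"
      unfolding R using \<open>inv\<close> True \<open>0 < m\<close> \<open>\<forall>x\<in>set \<alpha>. x = 0\<close>
      by (auto simp: c_words_def words_def)
    finally show ?thesis .
  next
    case False
    define j where "j = Max (set \<alpha>)"
    have "\<alpha> \<noteq> replicate (p - 1) 0"
      using False Max_replicate_zero_iff[OF ne] len by simp
    \<comment> \<open>Membership in \<open>a_seqs\<close> pins the index of the union to
      \<open>Max (set \<alpha>)\<close>.\<close>
    then have "(\<alpha>, \<beta>) \<in> splits n m p \<longleftrightarrow>
        j < m \<and> inv \<and> \<beta> \<in> map (\<lambda>x. x + (j + 1)) ` b_words (n - p) (m - j - 1)"
      using False \<open>0 < m\<close> unfolding splits_def a_seqs_def inv_def j_def by auto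
    also have "\<dots> \<longleftrightarrow> ?R"
    proof -
      \<comment> \<open>The inequality is strict because \<open>j\<close> occurs in \<alpha> and is
        nonzero, so it cannot recur in \<beta>.\<close>
      have "(\<forall>x\<in>set \<alpha>. \<forall>y\<in>set \<beta>. x \<le> y \<and> (x = y \<longrightarrow> x = 0)) \<longleftrightarrow> (\<forall>y\<in>set \<beta>. j < y)"
      proof
        assume "\<forall>x\<in>set \<alpha>. \<forall>y\<in>set \<beta>. x \<le> y \<and> (x = y \<longrightarrow> x = 0)"
        moreover have "j \<in> set \<alpha>" using ne by (simp add: j_def)
        ultimately show "\<forall>y\<in>set \<beta>. j < y" using False j_def by fastforce
      next
        assume *: "\<forall>y\<in>set \<beta>. j < y"
        have "\<forall>x\<in>set \<alpha>. x \<le> j" by (simp add: j_def)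
        then show "\<forall>x\<in>set \<alpha>. \<forall>y\<in>set \<beta>. x \<le> y \<and> (x = y \<longrightarrow> x = 0)"
          using * by fastforce
      qed
      \<comment> \<open>With all letters of \<beta> above \<open>j\<close>, none is zero, and the
        condition on nonzero letters becomes plain distinctness.\<close>
      moreover have "filter (\<lambda>x. x \<noteq> 0) \<beta> = \<beta>" if "\<forall>y\<in>set \<beta>. j < y"
        using that by (fastforce simp: filter_id_conv)
      ultimately show ?thesis
        unfolding R shifted_b_words_iff j_def[symmetric] by auto
    qed
    finally show ?thesis .
  qed
qed

section \<open>Counting the decompositions\<close>

lemma card_splits:
  assumes "0 < m" "m < p"
  shows "card (splits n m p) =
    num_c (n - p) m + (\<Sum>j=1..m-1. num_a (p - 1) j * num_b (n - p) (m - j - 1))"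
proof -
  let ?B = "\<lambda>j. map (\<lambda>x. x + (j + 1)) ` b_words (n - p) (m - j - 1)"
  let ?C = "{replicate (p - 1) 0} \<times> c_words (n - p) m"
  let ?AB = "\<Union>j\<in>{1..m-1}. a_seqs (p - 1) j \<times> ?B j"
  have finB: "finite (b_words r k)" and finC: "finite (c_words r k)" for r k
    by (auto simp: b_words_def c_words_def finite_words)
  have cardB: "card (?B j) = num_b (n - p) (m - j - 1)" for j
    unfolding num_b_def b_words_def[symmetric] by (intro card_image inj_on_mapI) (simp add: inj_on_def)
  \<comment> \<open>The pieces are told apart by the maximum of the left component: 0 for the first,
    \<open>j > 0\<close> for the others.\<close>
  have "Max (set (replicate (p - 1) (0::nat))) = 0" using assms by simp
  then have disj: "?C \<inter> ?AB = {}"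
    by (auto simp: a_seqs_def)
  have fin: "finite ?C" "finite ?AB"
    using finC finB finite_a_seqs by (blast intro: finite_cartesian_product)+
  have "card ?AB = (\<Sum>j=1..m-1. card (a_seqs (p - 1) j \<times> ?B j))"
    by (rule card_UN_disjoint) (use finite_a_seqs finB in \<open>auto simp: a_seqs_def simp del: One_nat_def\<close>)
  also have "\<dots> = (\<Sum>j=1..m-1. num_a (p - 1) j * num_b (n - p) (m - j - 1))"
    by (simp only: card_cartesian_product cardB num_a_def a_seqs_def)
  finally have cardAB: "card ?AB = (\<Sum>j=1..m-1. num_a (p - 1) j * num_b (n - p) (m - j - 1))" .
  have cardC: "card ?C = num_c (n - p) m"
    by (simp add: card_cartesian_product num_c_eq_card)
  show ?thesis
    unfolding splits_def card_Un_disjoint[OF fin disj] cardAB cardC by (rule refl)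
qed

lemma a_seqs_eq_UN_splits:
  assumes "0 < m" "0 < n"
  shows "a_seqs n m = (\<Union>p\<in>{m+1..n}. (\<lambda>(\<alpha>, \<beta>). \<alpha> @ m # \<beta>) ` splits n m p)"
    (is "_ = ?U")
proof (intro equalityI subsetI)
  fix \<sigma> assume "\<sigma> \<in> a_seqs n m"
  then have av: "\<sigma> \<in> avoiding_inversion_seqs n {[0,1,1],[1,2,0]}" and max: "Max (set \<sigma>) = m"
    by (auto simp: a_seqs_def)
  have "\<sigma> \<noteq> []" using av assms by (auto simp: mem_avoiding_iff simp del: One_nat_def)
  then have "m \<in> set \<sigma>" using max by (metis List.finite_set Max_in set_empty)
  then obtain \<alpha> \<beta> where \<sigma>: "\<sigma> = \<alpha> @ m # \<beta>" by (meson split_list)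
  have "x \<le> m" if "x \<in> set \<sigma>" for x using max that by auto
  \<comment> \<open>As \<open>m\<close> is nonzero, the displayed occurrence is its only one, so all
    other letters are strictly smaller.\<close>
  moreover have "m \<notin> set \<alpha>" "m \<notin> set \<beta>"
    using av assms unfolding mem_avoiding_iff \<sigma> by auto
  ultimately have "\<forall>x\<in>set \<alpha>. x < m" "\<forall>y\<in>set \<beta>. y < m"
    unfolding \<sigma> by (auto simp: le_less)
  moreover have len: "length \<alpha> + 1 \<le> n" using av by (auto simp: \<sigma> mem_avoiding_iff simp del: One_nat_def)
  \<comment> \<open>This is the inversion bound at the position of \<open>m\<close>; it yields the
    lower limit \<open>m + 1\<close> for \<open>p\<close>.\<close>
  moreover have "m \<le> length \<alpha>"
    using av len unfolding mem_avoiding_iff \<sigma> by (metis Suc_eq_plus1 Suc_le_eq nth_append_length)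
  ultimately have "(\<alpha>, \<beta>) \<in> splits n m (length \<alpha> + 1)"
    using av assms by (subst mem_splits_iff) (auto simp: \<sigma>)
  then show "\<sigma> \<in> ?U"
    using len \<open>m \<le> length \<alpha>\<close> unfolding \<sigma> by (intro UN_I[of "length \<alpha> + 1"]) force+
next
  fix \<sigma> assume "\<sigma> \<in> ?U"
  then obtain p \<alpha> \<beta> where "p \<in> {m+1..n}" "(\<alpha>, \<beta>) \<in> splits n m p" and \<sigma>: "\<sigma> = \<alpha> @ m # \<beta>"
    by auto
  then have "\<forall>x\<in>set \<alpha>. x < m" "\<forall>y\<in>set \<beta>. y < m"
    and "\<sigma> \<in> avoiding_inversion_seqs n {[0,1,1],[1,2,0]}"
    using mem_splits_iff[of m p n \<alpha> \<beta>] assms by auto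
  moreover from this have "Max (set \<sigma>) = m"
    unfolding \<sigma> by (intro Max_eqI) auto
  ultimately show "\<sigma> \<in> a_seqs n m" by (simp add: a_seqs_def)
qed

theorem theorem10:
  fixes m n :: nat
  assumes "0 < m" and "m < n"
  shows "num_a n m =
    (\<Sum>p=m+1..n. num_c (n - p) m + (\<Sum>j=1..m-1. num_a (p - 1) j * num_b (n - p) (m - j - 1)))"
proof -
  have n0: "0 < n" using assms by simp
  let ?f = "\<lambda>(\<alpha>, \<beta>). \<alpha> @ m # \<beta>"
  have mem: "m \<notin> set \<alpha>" "m \<notin> set \<beta>" "length \<alpha> = p - 1"
    if "(\<alpha>, \<beta>) \<in> splits n m p" "p \<in> {m+1..n}" for p \<alpha> \<beta>
    using that mem_splits_iff[of m p n \<alpha> \<beta>] \<open>0 < m\<close> by auto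
  \<comment> \<open>Since \<open>m\<close> occurs only once, the concatenation determines its
    halves. Allowing \<open>p\<close> and \<open>q\<close> to differ lets this give both injectivity
    for a fixed \<open>p\<close> and disjointness for different ones.\<close>
  have eq: "\<alpha> = \<alpha>' \<and> \<beta> = \<beta>'" if "(\<alpha>, \<beta>) \<in> splits n m p" "p \<in> {m+1..n}"
    "\<alpha> @ m # \<beta> = \<alpha>' @ m # \<beta>'" "(\<alpha>', \<beta>') \<in> splits n m q" "q \<in> {m+1..n}" for \<alpha> \<beta> \<alpha>' \<beta>' p q
    using that mem(1)[of \<alpha> \<beta> p] mem(2)[of \<alpha> \<beta> p]
    by (subst (asm) append_Cons_eq_iff) auto
  have inj: "inj_on ?f (splits n m p)" if "p \<in> {m+1..n}" for p
    using eq that by (fastforce intro!: inj_onI)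
  have "finite (splits n m p)" for p
    by (auto simp: splits_def c_words_def b_words_def finite_words finite_a_seqs)
  moreover have "?f ` splits n m p \<inter> ?f ` splits n m q = {}"
    if "p \<in> {m+1..n}" "q \<in> {m+1..n}" "p \<noteq> q" for p q
  proof (rule ccontr)
    assume "?f ` splits n m p \<inter> ?f ` splits n m q \<noteq> {}"
    then obtain \<alpha> \<beta> \<alpha>' \<beta>' where s: "(\<alpha>, \<beta>) \<in> splits n m p" "(\<alpha>', \<beta>') \<in> splits n m q"
      and "\<alpha> @ m # \<beta> = \<alpha>' @ m # \<beta>'"
      by (smt (verit) disjoint_iff image_iff case_prod_beta prod.collapse)
    then have "\<alpha> = \<alpha>'" using eq that by blast
    \<comment> \<open>The common left half has both lengths; as \<open>p\<close> and
      \<open>q\<close> are positive, truncated subtraction does no harm.\<close>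
    then have "p - 1 = q - 1" using mem(3) s that by metis
    then show False using that by auto
  qed
  ultimately have "card (a_seqs n m) = (\<Sum>p=m+1..n. card (?f ` splits n m p))"
    unfolding a_seqs_eq_UN_splits[OF \<open>0 < m\<close> n0]
    by (intro card_UN_disjoint) auto
  also have "\<dots> = (\<Sum>p=m+1..n. card (splits n m p))"
    by (intro sum.cong refl card_image inj)
  also have "\<dots> = (\<Sum>p=m+1..n. num_c (n - p) m + (\<Sum>j=1..m-1. num_a (p - 1) j * num_b (n - p) (m - j - 1)))"
    using \<open>0 < m\<close> by (intro sum.cong refl card_splits) auto
  finally show ?thesis by (simp add: num_a_def a_seqs_def)
qed

end
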